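(* Let $L=\langle R_i:i\in I\rangle$ be a finite relational language, $X$ a non-empty set, $\mathcal T$ an $L_{\infty\omega}$-theory and $\mathbb F_j$, $j\in J$, finite $L$-structures such that the poset $\mathbb P:=\langle\operatorname{Int}_L^{\mathcal T\cup\{\eta_{\mathbb F_j\not\hookrightarrow}:j\in J\}}(X),\subseteq\rangle$ is non-empty. Then: (a) if $\mathcal T\subseteq\mathcal F$, then $\mathbb P$ is union-complete and $\operatorname{Max}\mathbb P$ is a co-dense set in $\mathbb P$ consisting of reversible interpretations; (b) if $\mathcal T\subseteq\mathcal G$, then $\mathbb P$ is intersection-complete and $\operatorname{Min}\mathbb P$ is a dense set in $\mathbb P$ consisting of reversible interpretations; (c) for $\tau\in\operatorname{Int}_L(X)$: $\tau\in\operatorname{Max}(\operatorname{Int}_L^{\mathcal T\cup\{\eta_{\mathbb F_j\not\hookrightarrow}:j\in J\}}(X))$ iff $\tau^c\in\operatorname{Min}(\operatorname{Int}_L^{\mathcal T^c\cup\{\eta_{\mathbb F_j^c\not\hookrightarrow}:j\in J\}}(X))$.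
   Context: $\operatorname{ar}(R_i)=n_i$. $\operatorname{Int}_L(X)=\prod_{i\in I}P(X^{n_i})$ ordered componentwise by $\subseteq$; $\rho^c=\langle X^{n_i}\setminus\rho_i\rangle_i$; $\operatorname{Int}^{\mathcal T}_L(X)=\{\rho:\langle X,\rho\rangle\models\mathcal T\}$. Union-complete (intersection-complete): closed under unions (intersections) of chains. Dense (co-dense) $D$: every element is above (below) some element of $D$. Reversible: every bijective endomorphism of $\langle X,\rho\rangle$ is an automorphism. For a finite $L$-structure $\mathbb F=\langle m,\langle R_i^{\mathbb F}\rangle_i\rangle$ with $m=\{0,\dots,m-1\}$, let $\chi_i$ be the characteristic function of $R_i^{\mathbb F}\subseteq m^{n_i}$, write $\theta^1=\theta$, $\theta^0=\neg\theta$, and let $\eta_{\mathbb F\not\hookrightarrow}$ be the sentence $\forall v_0\dots v_{m-1}\big(\bigvee_{0\le j<k<m}v_j=v_k\vee\bigvee_{i\in I}\bigvee_{\bar x\in m^{n_i}}R_i(v_{x_0},\dots,v_{x_{n_i-1}})^{1-\chi_i(\bar x)}\big)$; a structure satisfies it iff $\mathbb F$ does not embed into it. $\mathbb F^c=\langle m,\langle m^{n_i}\setminus R_i^{\mathbb F}\rangle_i\rangle$. $L_{\infty\omega}$-formulas are built from atomic formulas $v_\alpha=v_\beta$, $R_i(\bar v)$ by $\neg,\forall,\exists$ and arbitrary $\bigwedge,\bigvee$. $\varphi^c$: $(v_\alpha=v_\beta)^c=v_\alpha=v_\beta$, $(R_i(\bar v))^c=\neg R_i(\bar v)$, and $^c$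 commutes with $\neg,\forall v_\alpha,\exists v_\alpha,\bigwedge,\bigvee$; $\mathcal T^c=\{\varphi^c:\varphi\in\mathcal T\}$. $\mathcal P$: smallest class containing atomic formulas and all $\neg v_\alpha=v_\beta$, closed under $\forall,\exists$, arbitrary $\bigwedge,\bigvee$. $\mathcal F$: smallest class containing $\mathcal P$ and all $\neg R_i(\bar v)$, closed under $\forall$, arbitrary $\bigwedge$, finite $\bigvee$. $\mathcal N$: smallest class containing all $\neg R_i(\bar v)$, $v_\alpha=v_\beta$, $\neg v_\alpha=v_\beta$, closed under $\forall,\exists$, arbitrary $\bigwedge,\bigvee$. $\mathcal G$: smallest class containing $\mathcal N$ and all $R_i(\bar v)$, closed under $\forall$, arbitrary $\bigwedge$, finite $\bigvee$. *)

theory Defs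
  imports Main "HOL-Library.FuncSet" "HOL-Library.Infinite_Typeclass"
begin

text \<open>
  A relational language is a set \<open>I\<close> of relation symbols with an arity function \<open>ar\<close>. The
  elements of \<open>X\<^sup>n\<close> are lists of length \<open>n\<close>.

  An interpretation is an extensional family, equal to \<open>undefined\<close> outside \<open>I\<close>. All
  interpretations thus agree outside \<open>I\<close>, so that on interpretations the order \<open>\<le>\<close> of the
  function space is the componentwise inclusion on \<open>I\<close>, and the suprema and infima of non-empty
  sets of interpretations are the componentwise unions and intersections.
\<close>

definition tuples :: "'a set \<Rightarrow> nat \<Rightarrow> 'a list set" where
  "tuples X n = {xs. length xs = n \<and> set xs \<subseteq> X}"

definition interps :: "'i set \<Rightarrow> ('i \<Rightarrow> nat) \<Rightarrow> 'a set \<Rightarrow> ('i \<Rightarrow> 'a list set) set" where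
  "interps I ar X = (\<Pi>\<^sub>E i\<in>I. Pow (tuples X (ar i)))"

definition compl_interp ::
  "'i set \<Rightarrow> ('i \<Rightarrow> nat) \<Rightarrow> 'a set \<Rightarrow> ('i \<Rightarrow> 'a list set) \<Rightarrow> 'i \<Rightarrow> 'a list set" where
  "compl_interp I ar X \<rho> = (\<lambda>i\<in>I. tuples X (ar i) - \<rho> i)"


text \<open>
  The formulas of \<open>L\<^sub>\<infinity>\<^sub>\<omega>\<close>, with variables indexed by the type \<open>'v\<close>. The formula
  \<open>Conj K f\<close> is the conjunction of the family \<open>f k\<close>, \<open>k \<in> K\<close>, where \<open>K\<close> is an arbitrary,
  possibly empty, subset of \<open>'k\<close>; similarly for \<open>Disj\<close>. The values of \<open>f\<close> outside \<open>K\<close> are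
  irrelevant. Since \<open>'k\<close> is a type parameter, there is no bound on the size of the index sets.
\<close>

datatype ('i, 'v, 'k) fm =
    Eq 'v 'v
  | Rel 'i "'v list"
  | Neg "('i, 'v, 'k) fm"
  | All 'v "('i, 'v, 'k) fm"
  | Ex 'v "('i, 'v, 'k) fm"
  | Conj "'k set" "'k \<Rightarrow> ('i, 'v, 'k) fm"
  | Disj "'k set" "'k \<Rightarrow> ('i, 'v, 'k) fm"

primrec fv :: "('i, 'v, 'k) fm \<Rightarrow> 'v set" where
  "fv (Eq a b) = {a, b}"
| "fv (Rel i vs) = set vs"
| "fv (Neg \<phi>) = fv \<phi>"
| "fv (All a \<phi>) = fv \<phi> - {a}"
| "fv (Ex a \<phi>) = fv \<phi> - {a}"
| "fv (Conj K f) = (\<Union>k\<in>K. fv (f k))"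
| "fv (Disj K f) = (\<Union>k\<in>K. fv (f k))"

inductive_set formulas :: "'i set \<Rightarrow> ('i \<Rightarrow> nat) \<Rightarrow> ('i, 'v, 'k) fm set"
  for I :: "'i set" and ar :: "'i \<Rightarrow> nat" where
  "Eq a b \<in> formulas I ar"
| "i \<in> I \<Longrightarrow> length vs = ar i \<Longrightarrow> Rel i vs \<in> formulas I ar"
| "\<phi> \<in> formulas I ar \<Longrightarrow> Neg \<phi> \<in> formulas I ar"
| "\<phi> \<in> formulas I ar \<Longrightarrow> All a \<phi> \<in> formulas I ar"
| "\<phi> \<in> formulas I ar \<Longrightarrow> Ex a \<phi> \<in> formulas I ar"
| "(\<And>k. k \<in> K \<Longrightarrow> f k \<in> formulas I ar) \<Longrightarrow> Conj K f \<in> formulas I ar"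
| "(\<And>k. k \<in> K \<Longrightarrow> f k \<in> formulas I ar) \<Longrightarrow> Disj K f \<in> formulas I ar"

definition sentences :: "'i set \<Rightarrow> ('i \<Rightarrow> nat) \<Rightarrow> ('i, 'v, 'k) fm set" where
  "sentences I ar = {\<phi> \<in> formulas I ar. fv \<phi> = {}}"

primrec sat ::
  "'a set \<Rightarrow> ('i \<Rightarrow> 'a list set) \<Rightarrow> ('i, 'v, 'k) fm \<Rightarrow> ('v \<Rightarrow> 'a) \<Rightarrow> bool" where
  "sat X \<rho> (Eq a b) = (\<lambda>s. s a = s b)"
| "sat X \<rho> (Rel i vs) = (\<lambda>s. map s vs \<in> \<rho> i)"
| "sat X \<rho> (Neg \<phi>) = (\<lambda>s. \<not> sat X \<rho> \<phi> s)"
| "sat X \<rho> (All a \<phi>) = (\<lambda>s. \<forall>x\<in>X. sat X \<rho> \<phi> (s(a := x)))"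
| "sat X \<rho> (Ex a \<phi>) = (\<lambda>s. \<exists>x\<in>X. sat X \<rho> \<phi> (s(a := x)))"
| "sat X \<rho> (Conj K f) = (\<lambda>s. \<forall>k\<in>K. sat X \<rho> (f k) s)"
| "sat X \<rho> (Disj K f) = (\<lambda>s. \<exists>k\<in>K. sat X \<rho> (f k) s)"

definition models :: "'a set \<Rightarrow> ('i \<Rightarrow> 'a list set) \<Rightarrow> ('i, 'v, 'k) fm set \<Rightarrow> bool" where
  "models X \<rho> T \<longleftrightarrow> (\<forall>\<phi>\<in>T. \<forall>s. range s \<subseteq> X \<longrightarrow> sat X \<rho> \<phi> s)"

definition interps_of ::
  "'i set \<Rightarrow> ('i \<Rightarrow> nat) \<Rightarrow> ('i, 'v, 'k) fm set \<Rightarrow> 'a set \<Rightarrow> ('i \<Rightarrow> 'a list set) set" where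
  "interps_of I ar T X = {\<rho> \<in> interps I ar X. models X \<rho> T}"

primrec compl_fm :: "('i, 'v, 'k) fm \<Rightarrow> ('i, 'v, 'k) fm" where
  "compl_fm (Eq a b) = Eq a b"
| "compl_fm (Rel i vs) = Neg (Rel i vs)"
| "compl_fm (Neg \<phi>) = Neg (compl_fm \<phi>)"
| "compl_fm (All a \<phi>) = All a (compl_fm \<phi>)"
| "compl_fm (Ex a \<phi>) = Ex a (compl_fm \<phi>)"
| "compl_fm (Conj K f) = Conj K (\<lambda>k. compl_fm (f k))"
| "compl_fm (Disj K f) = Disj K (\<lambda>k. compl_fm (f k))"

inductive_set class_P :: "'i set \<Rightarrow> ('i \<Rightarrow> nat) \<Rightarrow> ('i, 'v, 'k) fm set"
  for I :: "'i set" and ar :: "'i \<Rightarrow> nat" where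
  "Eq a b \<in> class_P I ar"
| "i \<in> I \<Longrightarrow> length vs = ar i \<Longrightarrow> Rel i vs \<in> class_P I ar"
| "Neg (Eq a b) \<in> class_P I ar"
| "\<phi> \<in> class_P I ar \<Longrightarrow> All a \<phi> \<in> class_P I ar"
| "\<phi> \<in> class_P I ar \<Longrightarrow> Ex a \<phi> \<in> class_P I ar"
| "(\<And>k. k \<in> K \<Longrightarrow> f k \<in> class_P I ar) \<Longrightarrow> Conj K f \<in> class_P I ar"
| "(\<And>k. k \<in> K \<Longrightarrow> f k \<in> class_P I ar) \<Longrightarrow> Disj K f \<in> class_P I ar"

inductive_set class_F :: "'i set \<Rightarrow> ('i \<Rightarrow> nat) \<Rightarrow> ('i, 'v, 'k) fm set"
  for I :: "'i set" and ar :: "'i \<Rightarrow> nat" where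
  "\<phi> \<in> class_P I ar \<Longrightarrow> \<phi> \<in> class_F I ar"
| "i \<in> I \<Longrightarrow> length vs = ar i \<Longrightarrow> Neg (Rel i vs) \<in> class_F I ar"
| "\<phi> \<in> class_F I ar \<Longrightarrow> All a \<phi> \<in> class_F I ar"
| "(\<And>k. k \<in> K \<Longrightarrow> f k \<in> class_F I ar) \<Longrightarrow> Conj K f \<in> class_F I ar"
| "finite K \<Longrightarrow> (\<And>k. k \<in> K \<Longrightarrow> f k \<in> class_F I ar) \<Longrightarrow> Disj K f \<in> class_F I ar"

inductive_set class_N :: "'i set \<Rightarrow> ('i \<Rightarrow> nat) \<Rightarrow> ('i, 'v, 'k) fm set"
  for I :: "'i set" and ar :: "'i \<Rightarrow> nat" where
  "i \<in> I \<Longrightarrow> length vs = ar i \<Longrightarrow> Neg (Rel i vs) \<in> class_N I ar"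
| "Eq a b \<in> class_N I ar"
| "Neg (Eq a b) \<in> class_N I ar"
| "\<phi> \<in> class_N I ar \<Longrightarrow> All a \<phi> \<in> class_N I ar"
| "\<phi> \<in> class_N I ar \<Longrightarrow> Ex a \<phi> \<in> class_N I ar"
| "(\<And>k. k \<in> K \<Longrightarrow> f k \<in> class_N I ar) \<Longrightarrow> Conj K f \<in> class_N I ar"
| "(\<And>k. k \<in> K \<Longrightarrow> f k \<in> class_N I ar) \<Longrightarrow> Disj K f \<in> class_N I ar"

inductive_set class_G :: "'i set \<Rightarrow> ('i \<Rightarrow> nat) \<Rightarrow> ('i, 'v, 'k) fm set"
  for I :: "'i set" and ar :: "'i \<Rightarrow> nat" where
  "\<phi> \<in> class_N I ar \<Longrightarrow> \<phi> \<in> class_G I ar"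
| "i \<in> I \<Longrightarrow> length vs = ar i \<Longrightarrow> Rel i vs \<in> class_G I ar"
| "\<phi> \<in> class_G I ar \<Longrightarrow> All a \<phi> \<in> class_G I ar"
| "(\<And>k. k \<in> K \<Longrightarrow> f k \<in> class_G I ar) \<Longrightarrow> Conj K f \<in> class_G I ar"
| "finite K \<Longrightarrow> (\<And>k. k \<in> K \<Longrightarrow> f k \<in> class_G I ar) \<Longrightarrow> Disj K f \<in> class_G I ar"


text \<open>
  A disjunction \<open>disj_over A g\<close> over a finite index set \<open>A\<close> of any type is written as a \<open>Disj\<close> by
  transporting the indices along some injection \<open>e\<close> of \<open>A\<close> into \<open>'k\<close>; one exists because \<open>'k\<close>
  is infinite.
\<close>

definition disj_over :: "'b set \<Rightarrow> ('b \<Rightarrow> ('i, 'v, 'k::infinite) fm) \<Rightarrow> ('i, 'v, 'k) fm" where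
  "disj_over A g =
    (let e = (SOME e. inj_on e A) in Disj (e ` A) (\<lambda>k. g (inv_into A e k)))"

definition disj2 ::
  "('i, 'v, 'k::infinite) fm \<Rightarrow> ('i, 'v, 'k) fm \<Rightarrow> ('i, 'v, 'k) fm" where
  "disj2 \<phi> \<psi> = disj_over UNIV (\<lambda>b::bool. if b then \<phi> else \<psi>)"

lemma sat_disj_over:
  fixes g :: "'b \<Rightarrow> ('i, 'v, 'k::infinite) fm"
  assumes "finite A"
  shows "sat X \<rho> (disj_over A g) s \<longleftrightarrow> (\<exists>a\<in>A. sat X \<rho> (g a) s)"
proof -
  obtain B :: "'k set" where B: "finite B" "card B = card A"
    using infinite_arbitrarily_large[OF infinite_UNIV] by blast
  obtain h where "bij_betw h A B"
    using finite_same_card_bij[OF assms B(1) B(2)[symmetric]] by blast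
  then have "\<exists>e :: 'b \<Rightarrow> 'k. inj_on e A"
    using bij_betw_imp_inj_on by blast
  then have "inj_on (SOME e :: 'b \<Rightarrow> 'k. inj_on e A) A"
    by (rule someI_ex)
  then show ?thesis
    by (simp add: disj_over_def Let_def inv_into_f_f)
qed

lemma sat_disj2: "sat X \<rho> (disj2 \<phi> \<psi>) s \<longleftrightarrow> sat X \<rho> \<phi> s \<or> sat X \<rho> \<psi> s"
  by (auto simp: disj2_def sat_disj_over UNIV_bool)

text \<open>
  The sentence saying that the structure \<open>\<langle>m, F\<rangle>\<close> with domain \<open>{..<m}\<close> does not embed; \<open>v n\<close> is
  the variable \<open>v\<^sub>n\<close>.
\<close>

definition eta ::
  "'i set \<Rightarrow> ('i \<Rightarrow> nat) \<Rightarrow> (nat \<Rightarrow> 'v) \<Rightarrow> nat \<Rightarrow> ('i \<Rightarrow> nat list set)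
    \<Rightarrow> ('i, 'v, 'k::infinite) fm" where
  "eta I ar v m F =
    foldr (\<lambda>n. All (v n)) [0..<m]
      (disj2
        (disj_over {(j, k). j < k \<and> k < m} (\<lambda>(j, k). Eq (v j) (v k)))
        (disj_over I (\<lambda>i. disj_over (tuples {..<m} (ar i))
          (\<lambda>x. if x \<in> F i then Neg (Rel i (map v x)) else Rel i (map v x)))))"


definition endomorphism :: "'i set \<Rightarrow> 'a set \<Rightarrow> ('i \<Rightarrow> 'a list set) \<Rightarrow> ('a \<Rightarrow> 'a) \<Rightarrow> bool" where
  "endomorphism I X \<rho> f \<longleftrightarrow> f ` X \<subseteq> X \<and> (\<forall>i\<in>I. \<forall>xs\<in>\<rho> i. map f xs \<in> \<rho> i)"

definition automorphism ::
  "'i set \<Rightarrow> ('i \<Rightarrow> nat) \<Rightarrow> 'a set \<Rightarrow> ('i \<Rightarrow> 'a list set) \<Rightarrow> ('a \<Rightarrow> 'a) \<Rightarrow> bool" where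
  "automorphism I ar X \<rho> f \<longleftrightarrow>
    bij_betw f X X \<and> (\<forall>i\<in>I. \<forall>xs\<in>tuples X (ar i). xs \<in> \<rho> i \<longleftrightarrow> map f xs \<in> \<rho> i)"

definition reversible :: "'i set \<Rightarrow> ('i \<Rightarrow> nat) \<Rightarrow> 'a set \<Rightarrow> ('i \<Rightarrow> 'a list set) \<Rightarrow> bool" where
  "reversible I ar X \<rho> \<longleftrightarrow>
    (\<forall>f. endomorphism I X \<rho> f \<and> bij_betw f X X \<longrightarrow> automorphism I ar X \<rho> f)"


text \<open>
  Chains are taken to be non-empty. For a set of interpretations, \<open>Sup C\<close> and \<open>Inf C\<close> are then
  the componentwise union and intersection of the chain \<open>C\<close>.
\<close>

definition union_complete :: "'p::complete_lattice set \<Rightarrow> bool" where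
  "union_complete P \<longleftrightarrow>
    (\<forall>C. C \<subseteq> P \<and> C \<noteq> {} \<and> Complete_Partial_Order.chain (\<le>) C \<longrightarrow> Sup C \<in> P)"

definition intersection_complete :: "'p::complete_lattice set \<Rightarrow> bool" where
  "intersection_complete P \<longleftrightarrow>
    (\<forall>C. C \<subseteq> P \<and> C \<noteq> {} \<and> Complete_Partial_Order.chain (\<le>) C \<longrightarrow> Inf C \<in> P)"

definition maximals :: "'p::order set \<Rightarrow> 'p set" where
  "maximals P = {x \<in> P. \<forall>y\<in>P. x \<le> y \<longrightarrow> y = x}"

definition minimals :: "'p::order set \<Rightarrow> 'p set" where
  "minimals P = {x \<in> P. \<forall>y\<in>P. y \<le> x \<longrightarrow> y = x}"

definition dense_in :: "'p::order set \<Rightarrow> 'p set \<Rightarrow> bool" where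
  "dense_in D P \<longleftrightarrow> D \<subseteq> P \<and> (\<forall>x\<in>P. \<exists>d\<in>D. d \<le> x)"

definition codense_in :: "'p::order set \<Rightarrow> 'p set \<Rightarrow> bool" where
  "codense_in D P \<longleftrightarrow> D \<subseteq> P \<and> (\<forall>x\<in>P. \<exists>d\<in>D. x \<le> d)"

end

theory Submission
  imports Defs
begin

text \<open>
  Formulas in \<open>\<P>\<close> are preserved upwards. If the union of a chain violates a formula in \<open>\<F>\<close>, then
  so does a whole final segment of the chain; for a finite disjunction one takes the largest of
  finitely many segment bounds. The sentences \<open>\<eta>\<close> lie in both \<open>\<F>\<close> and \<open>\<G>\<close>, so Zorn's lemma yields
  maximal elements in (a) and, dually, minimal ones in (b). A bijective endomorphism \<open>f\<close> of a maximal
  \<open>\<tau>\<close> is an isomorphism from the preimage of \<open>\<tau>\<close> under \<open>f\<close>, which contains \<open>\<tau>\<close> and hence equals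
  \<open>\<tau>\<close>; for a minimal \<open>\<tau>\<close> one uses the image instead. Part (c) holds because complementation is an
  order-reversing bijection between the two sets of interpretations.
\<close>

section \<open>Tuples, assignments and well-formedness\<close>

lemma map_in_tuples:
  "range s \<subseteq> X \<Longrightarrow> length vs = n \<Longrightarrow> map s vs \<in> tuples X n"
  by (auto simp: tuples_def)

lemma finite_tuples: "finite A \<Longrightarrow> finite (tuples A n)"
  using finite_lists_length_eq[of A n] by (simp add: tuples_def conj_commute)

lemma range_fun_upd_subset: "range s \<subseteq> X \<Longrightarrow> x \<in> X \<Longrightarrow> range (s(a := x)) \<subseteq> X"
  by auto

lemma class_P_formulas: "\<phi> \<in> class_P I ar \<Longrightarrow> \<phi> \<in> formulas I ar"
  by (induction rule: class_P.induct) (auto intro: formulas.intros)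

lemma class_F_formulas: "\<phi> \<in> class_F I ar \<Longrightarrow> \<phi> \<in> formulas I ar"
  by (induction rule: class_F.induct) (auto intro: formulas.intros class_P_formulas)

section \<open>The sentences \<open>eta\<close> lie in both classes\<close>

lemma class_F_disj_over:
  assumes "finite A" and "\<And>a. a \<in> A \<Longrightarrow> g a \<in> class_F I ar"
  shows "disj_over A g \<in> class_F I ar"
  unfolding disj_over_def Let_def
  by (intro class_F.intros(5) finite_imageI assms inv_into_into)

lemma class_G_disj_over:
  assumes "finite A" and "\<And>a. a \<in> A \<Longrightarrow> g a \<in> class_G I ar"
  shows "disj_over A g \<in> class_G I ar"
  unfolding disj_over_def Let_def
  by (intro class_G.intros(5) finite_imageI assms inv_into_into)

lemma finite_increasing_pairs: "finite {(j, k). j < k \<and> k < (m::nat)}"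
  by (rule finite_subset[of _ "{..<m} \<times> {..<m}"]) auto

lemma class_F_foldr_All: "\<phi> \<in> class_F I ar \<Longrightarrow> foldr (\<lambda>n. All (v n)) ns \<phi> \<in> class_F I ar"
  by (induction ns) (auto intro: class_F.intros)

lemma class_G_foldr_All: "\<phi> \<in> class_G I ar \<Longrightarrow> foldr (\<lambda>n. All (v n)) ns \<phi> \<in> class_G I ar"
  by (induction ns) (auto intro: class_G.intros)

text \<open>Finiteness of \<open>I\<close> and of the tuples over \<open>{..<m}\<close> makes every
  disjunction in \<open>eta\<close> finite. Positive literals enter through \<open>class_P\<close>,
  negated relational atoms directly; for \<open>class_G\<close> these two routes are exchanged, with
  equations entering through \<open>class_N\<close>.\<close>

lemma eta_in_class_F: "finite I \<Longrightarrow> eta I ar v m F \<in> class_F I ar"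
  unfolding eta_def disj2_def
  by (intro class_F_foldr_All class_F_disj_over)
    (auto intro!: class_F_disj_over finite_increasing_pairs finite_tuples class_F.intros(2)
        class_F.intros(1)[OF class_P.intros(1)] class_F.intros(1)[OF class_P.intros(2)],
      simp_all add: tuples_def)

lemma eta_in_class_G: "finite I \<Longrightarrow> eta I ar v m F \<in> class_G I ar"
  unfolding eta_def disj2_def
  by (intro class_G_foldr_All class_G_disj_over)
    (auto intro!: class_G_disj_over finite_increasing_pairs finite_tuples class_G.intros(2)
        class_G.intros(1)[OF class_N.intros(2)] class_G.intros(1)[OF class_N.intros(1)],
      simp_all add: tuples_def)

section \<open>Preservation along unions and intersections of chains\<close>

text \<open>Negation occurs only before equations, whose truth does not depend on the
  interpretation; everything else is monotone because the domain \<open>X\<close> stays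
  fixed.\<close>

lemma class_P_mono:
  assumes "\<phi> \<in> class_P I ar" and "\<rho> \<le> \<sigma>" and "sat X \<rho> \<phi> s"
  shows "sat X \<sigma> \<phi> s"
  using assms(1,3)
proof (induction arbitrary: s rule: class_P.induct)
  case (2 i vs)
  then show ?case
    using le_funD[OF assms(2), of i] by auto
qed fastforce+

lemma class_N_antimono:
  assumes "\<phi> \<in> class_N I ar" and "\<sigma> \<le> \<rho>" and "sat X \<rho> \<phi> s"
  shows "sat X \<sigma> \<phi> s"
  using assms(1,3)
proof (induction arbitrary: s rule: class_N.induct)
  case (1 i vs)
  then show ?case
    using le_funD[OF assms(2), of i] by auto
qed fastforce+

text \<open>Stated for an arbitrary transitive \<open>ord\<close>, so that it serves both
  \<open>\<le>\<close> and its converse.\<close>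

lemma chain_finite_bound:
  assumes "Complete_Partial_Order.chain ord C" and "transp ord" and "C \<noteq> {}"
    and "finite K" and "\<forall>k\<in>K. r k \<in> C"
  shows "\<exists>u\<in>C. \<forall>k\<in>K. ord (r k) u"
  using assms(4,5)
proof (induction K)
  case empty
  then show ?case using assms(3) by blast
next
  case (insert k K)
  then obtain u where u: "u \<in> C" "\<forall>k\<in>K. ord (r k) u"
    by auto
  \<comment> \<open>The second fact is reflexivity at \<open>r k\<close>, got by comparing
    \<open>r k\<close> with itself in the chain.\<close>
  have "ord (r k) u \<or> ord u (r k)" "ord (r k) (r k)"
    using chainD[OF assms(1)] insert.prems u(1) by auto
  then show ?case
    using u insert.prems transpD[OF assms(2), of _ u "r k"]
    by (cases "ord (r k) u") (auto intro: bexI[of _ "r k"])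
qed

text \<open>The induction needs violation on a whole final segment: single members violating the
  separate disjuncts need not yield a common one, whereas finitely many final segments of a chain
  intersect.\<close>

lemma class_F_Sup_chain:
  assumes "\<phi> \<in> class_F I ar" and chain: "Complete_Partial_Order.chain (\<le>) C" and ne: "C \<noteq> {}"
    and "\<not> sat X (Sup C) \<phi> s"
  shows "\<exists>\<rho>\<in>C. \<forall>\<sigma>\<in>C. \<rho> \<le> \<sigma> \<longrightarrow> \<not> sat X \<sigma> \<phi> s"
  using assms(1,4)
proof (induction arbitrary: s rule: class_F.induct)
  case (1 \<phi>)
  have "\<not> sat X \<sigma> \<phi> s" if "\<sigma> \<in> C" for \<sigma>
    using class_P_mono[OF 1(1) Sup_upper[OF that]] 1(2) by blast
  then show ?case
    using ne by blast
next
  \<comment> \<open>A tuple in the union lies in some member, and then in all larger ones.\<close>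
  case (2 i vs)
  then obtain \<rho> where "\<rho> \<in> C" "map s vs \<in> \<rho> i"
    by auto
  then show ?case
    by (intro bexI[of _ \<rho>]) (auto simp: le_fun_def)
next
  case (3 \<phi> a)
  then obtain x where x: "x \<in> X" "\<not> sat X (Sup C) \<phi> (s(a := x))"
    unfolding sat.simps by blast
  from 3(2)[OF x(2)] show ?case
    using x(1) unfolding sat.simps by blast
next
  case (4 K f)
  then obtain k where k: "k \<in> K" "\<not> sat X (Sup C) (f k) s"
    unfolding sat.simps by blast
  from 4(2)[OF k] show ?case
    using k(1) unfolding sat.simps by blast
next
  case (5 K f)
  then have "\<forall>k\<in>K. \<exists>\<rho>\<in>C. \<forall>\<sigma>\<in>C. \<rho> \<le> \<sigma> \<longrightarrow> \<not> sat X \<sigma> (f k) s"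
    unfolding sat.simps by blast
  then obtain r where r: "\<forall>k\<in>K. r k \<in> C \<and> (\<forall>\<sigma>\<in>C. r k \<le> \<sigma> \<longrightarrow> \<not> sat X \<sigma> (f k) s)"
    by metis
  obtain u where "u \<in> C" "\<forall>k\<in>K. r k \<le> u"
    using chain_finite_bound[OF chain _ ne 5(1), of r] r by (auto simp: transp_def)
  with r show ?case
    by (intro bexI[of _ u]) (auto intro: order_trans)
qed

lemma class_G_Inf_chain:
  assumes "\<phi> \<in> class_G I ar" and chain: "Complete_Partial_Order.chain (\<le>) C" and ne: "C \<noteq> {}"
    and "\<not> sat X (Inf C) \<phi> s"
  shows "\<exists>\<rho>\<in>C. \<forall>\<sigma>\<in>C. \<sigma> \<le> \<rho> \<longrightarrow> \<not> sat X \<sigma> \<phi> s"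
  using assms(1,4)
proof (induction arbitrary: s rule: class_G.induct)
  case (1 \<phi>)
  have "\<not> sat X \<sigma> \<phi> s" if "\<sigma> \<in> C" for \<sigma>
    using class_N_antimono[OF 1(1) Inf_lower[OF that]] 1(2) by blast
  then show ?case
    using ne by blast
next
  case (2 i vs)
  then obtain \<rho> where "\<rho> \<in> C" "map s vs \<notin> \<rho> i"
    by auto
  then show ?case
    by (intro bexI[of _ \<rho>]) (auto simp: le_fun_def)
next
  case (3 \<phi> a)
  then obtain x where x: "x \<in> X" "\<not> sat X (Inf C) \<phi> (s(a := x))"
    unfolding sat.simps by blast
  from 3(2)[OF x(2)] show ?case
    using x(1) unfolding sat.simps by blast
next
  case (4 K f)
  then obtain k where k: "k \<in> K" "\<not> sat X (Inf C) (f k) s"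
    unfolding sat.simps by blast
  from 4(2)[OF k] show ?case
    using k(1) unfolding sat.simps by blast
next
  case (5 K f)
  then have "\<forall>k\<in>K. \<exists>\<rho>\<in>C. \<forall>\<sigma>\<in>C. \<sigma> \<le> \<rho> \<longrightarrow> \<not> sat X \<sigma> (f k) s"
    unfolding sat.simps by blast
  then obtain r where r: "\<forall>k\<in>K. r k \<in> C \<and> (\<forall>\<sigma>\<in>C. \<sigma> \<le> r k \<longrightarrow> \<not> sat X \<sigma> (f k) s)"
    by metis
  \<comment> \<open>Reversing the order turns the least of finitely many bounds into an instance of
    \<open>chain_finite_bound\<close>.\<close>
  have "Complete_Partial_Order.chain (\<ge>) C"
    using chain by (auto simp: chain_def)
  then obtain u where "u \<in> C" "\<forall>k\<in>K. u \<le> r k"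
    using chain_finite_bound[of "(\<ge>)" C K r] ne 5(1) r by (auto simp: transp_def)
  with r show ?case
    by (intro bexI[of _ u]) (auto intro: order_trans)
qed

section \<open>Completeness of sets of models\<close>

lemma Sup_in_interps:
  assumes "C \<subseteq> interps I ar X" and "C \<noteq> {}"
  shows "Sup C \<in> interps I ar X"
proof -
  have "Sup C i = undefined" if "i \<notin> I" for i
  proof -
    have "\<rho> i = undefined" if "\<rho> \<in> C" for \<rho>
      using that \<open>i \<notin> I\<close> assms(1) PiE_arb[of \<rho> I] by (auto simp: interps_def)
    \<comment> \<open>Non-emptiness of \<open>C\<close> matters here: an empty supremum would be the
      empty set outside \<open>I\<close> instead of \<open>undefined\<close>.\<close>
    then have "(\<lambda>\<rho>. \<rho> i) ` C = {undefined}"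
      using assms(2) by auto
    then show ?thesis by simp
  qed
  moreover have "Sup C i \<subseteq> tuples X (ar i)" if "i \<in> I" for i
    using that assms unfolding interps_def by (fastforce dest: PiE_mem)
  ultimately show ?thesis
    unfolding interps_def by (intro PiE_I) auto
qed

lemma Inf_in_interps:
  assumes "C \<subseteq> interps I ar X" and "C \<noteq> {}"
  shows "Inf C \<in> interps I ar X"
proof -
  have "Inf C i = undefined" if "i \<notin> I" for i
  proof -
    have "\<rho> i = undefined" if "\<rho> \<in> C" for \<rho>
      using that \<open>i \<notin> I\<close> assms(1) PiE_arb[of \<rho> I] by (auto simp: interps_def)
    then have "(\<lambda>\<rho>. \<rho> i) ` C = {undefined}"
      using assms(2) by auto
    then show ?thesis by simp
  qed
  moreover have "Inf C i \<subseteq> tuples X (ar i)" if "i \<in> I" for i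
    using that assms unfolding interps_def by (fastforce dest: PiE_mem)
  ultimately show ?thesis
    unfolding interps_def by (intro PiE_I) auto
qed

lemma union_complete_interps_of:
  fixes I :: "'i set" and X :: "'a set"
  assumes "T \<subseteq> class_F I ar"
  shows "union_complete (interps_of I ar T X)"
  unfolding union_complete_def
proof (intro allI impI, elim conjE)
  fix C :: "('i \<Rightarrow> 'a list set) set"
  assume C: "C \<subseteq> interps_of I ar T X" "C \<noteq> {}" "Complete_Partial_Order.chain (\<le>) C"
  have "sat X (Sup C) \<phi> s" if "\<phi> \<in> T" "range s \<subseteq> X" for \<phi> s
  proof (rule ccontr)
    assume "\<not> sat X (Sup C) \<phi> s"
    moreover have "\<phi> \<in> class_F I ar"
      using assms that(1) ..
    ultimately obtain \<rho> where "\<rho> \<in> C" and "\<forall>\<sigma>\<in>C. \<rho> \<le> \<sigma> \<longrightarrow> \<not> sat X \<sigma> \<phi> s"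
      using class_F_Sup_chain[OF _ C(3,2)] by blast
    \<comment> \<open>The violating segment contains its own starting point, but
      \<open>\<rho>\<close> is a model.\<close>
    then have "\<not> sat X \<rho> \<phi> s"
      by simp
    moreover have "models X \<rho> T"
      using C(1) \<open>\<rho> \<in> C\<close> by (auto simp: interps_of_def)
    ultimately show False
      using that by (simp add: models_def)
  qed
  moreover have "Sup C \<in> interps I ar X"
    using C by (intro Sup_in_interps) (auto simp: interps_of_def)
  ultimately show "Sup C \<in> interps_of I ar T X"
    by (simp add: interps_of_def models_def)
qed

lemma intersection_complete_interps_of:
  fixes I :: "'i set" and X :: "'a set"
  assumes "T \<subseteq> class_G I ar"
  shows "intersection_complete (interps_of I ar T X)"
  unfolding intersection_complete_def
proof (intro allI impI, elim conjE)
  fix C :: "('i \<Rightarrow> 'a list set) set"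
  assume C: "C \<subseteq> interps_of I ar T X" "C \<noteq> {}" "Complete_Partial_Order.chain (\<le>) C"
  have "sat X (Inf C) \<phi> s" if "\<phi> \<in> T" "range s \<subseteq> X" for \<phi> s
  proof (rule ccontr)
    assume "\<not> sat X (Inf C) \<phi> s"
    moreover have "\<phi> \<in> class_G I ar"
      using assms that(1) ..
    ultimately obtain \<rho> where "\<rho> \<in> C" and "\<forall>\<sigma>\<in>C. \<sigma> \<le> \<rho> \<longrightarrow> \<not> sat X \<sigma> \<phi> s"
      using class_G_Inf_chain[OF _ C(3,2)] by blast
    then have "\<not> sat X \<rho> \<phi> s"
      by simp
    moreover have "models X \<rho> T"
      using C(1) \<open>\<rho> \<in> C\<close> by (auto simp: interps_of_def)
    ultimately show False
      using that by (simp add: models_def)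
  qed
  moreover have "Inf C \<in> interps I ar X"
    using C by (intro Inf_in_interps) (auto simp: interps_of_def)
  ultimately show "Inf C \<in> interps_of I ar T X"
    by (simp add: interps_of_def models_def)
qed

section \<open>Extremal elements by Zorn's lemma\<close>

lemma union_complete_codense_maximals:
  assumes "union_complete P"
  shows "codense_in (maximals P) P"
  unfolding codense_in_def
proof (intro conjI ballI)
  show "maximals P \<subseteq> P"
    by (auto simp: maximals_def)
  fix x assume x: "x \<in> P"
  \<comment> \<open>Zorn's lemma is applied to the part of \<open>P\<close> above \<open>x\<close>,
    so that the maximal element obtained lies above \<open>x\<close>.\<close>
  define A where "A = {y \<in> P. x \<le> y}"
  have "\<exists>m\<in>A. \<forall>a\<in>A. m \<le> a \<longrightarrow> a = m"
  proof (rule predicate_Zorn)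
    show "partial_order_on A (relation_of (\<le>) A)"
      by (intro partial_order_on_relation_ofI) auto
    fix C assume "C \<in> Chains (relation_of (\<le>) A)"
    then have C: "C \<subseteq> A" "Complete_Partial_Order.chain (\<le>) C"
      by (auto simp: Chains_def relation_of_def chain_def)
    show "\<exists>u\<in>A. \<forall>a\<in>C. a \<le> u"
    \<comment> \<open>Completeness concerns non-empty chains only; the empty chain is bounded by
      \<open>x\<close> itself.\<close>
    proof (cases "C = {}")
      case True
      then show ?thesis using x A_def by auto
    next
      case False
      then obtain c where c: "c \<in> C"
        by blast
      have "Sup C \<in> P"
        using assms C False by (auto simp: union_complete_def A_def)
      moreover have "x \<le> Sup C"
        using c C(1) by (auto simp: A_def intro: Sup_upper2)
      ultimately show ?thesis
        by (intro bexI[of _ "Sup C"]) (auto simp: A_def Sup_upper)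
    qed
  qed
  then obtain d where d: "d \<in> A" "\<forall>a\<in>A. d \<le> a \<longrightarrow> a = d"
    by blast
  \<comment> \<open>Whatever lies above \<open>d\<close> in \<open>P\<close> is above
    \<open>x\<close>, hence in \<open>A\<close>.\<close>
  then have "d \<in> maximals P"
    using order_trans[of x d] by (simp add: A_def maximals_def)
  with d(1) show "\<exists>d\<in>maximals P. x \<le> d"
    by (auto simp: A_def)
qed

lemma intersection_complete_dense_minimals:
  assumes "intersection_complete P"
  shows "dense_in (minimals P) P"
  unfolding dense_in_def
proof (intro conjI ballI)
  show "minimals P \<subseteq> P"
    by (auto simp: minimals_def)
  fix x assume x: "x \<in> P"
  define A where "A = {y \<in> P. y \<le> x}"
  \<comment> \<open>Zorn's lemma for the reversed order: its upper bounds are lower bounds, supplied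
    by infima.\<close>
  have "\<exists>m\<in>A. \<forall>a\<in>A. m \<ge> a \<longrightarrow> a = m"
  proof (rule predicate_Zorn)
    show "partial_order_on A (relation_of (\<ge>) A)"
      by (intro partial_order_on_relation_ofI) auto
    fix C assume "C \<in> Chains (relation_of (\<ge>) A)"
    then have C: "C \<subseteq> A" "Complete_Partial_Order.chain (\<le>) C"
      by (auto simp: Chains_def relation_of_def chain_def)
    show "\<exists>u\<in>A. \<forall>a\<in>C. a \<ge> u"
    proof (cases "C = {}")
      case True
      then show ?thesis using x A_def by auto
    next
      case False
      then obtain c where c: "c \<in> C"
        by blast
      have "Inf C \<in> P"
        using assms C False by (auto simp: intersection_complete_def A_def)
      moreover have "Inf C \<le> x"
        using c C(1) by (auto simp: A_def intro: Inf_lower2)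
      ultimately show ?thesis
        by (intro bexI[of _ "Inf C"]) (auto simp: A_def Inf_lower)
    qed
  qed
  then obtain d where d: "d \<in> A" "\<forall>a\<in>A. a \<le> d \<longrightarrow> a = d"
    by blast
  then have "d \<in> minimals P"
    using order_trans[of _ d x] by (simp add: A_def minimals_def)
  with d(1) show "\<exists>d\<in>minimals P. d \<le> x"
    by (auto simp: A_def)
qed

section \<open>Isomorphism invariance and reversibility\<close>

lemma models_Un: "models X \<rho> (S \<union> T) \<longleftrightarrow> models X \<rho> S \<and> models X \<rho> T"
  by (auto simp: models_def)

text \<open>Injectivity of \<open>f\<close> preserves equations in both directions,
  \<open>iso\<close> handles relational atoms, and surjectivity lets quantifiers over
  \<open>X\<close> be reindexed along \<open>f\<close>.\<close>

lemma sat_isomorphism: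
  assumes "\<phi> \<in> formulas I ar" and bij: "bij_betw f X X"
    and iso: "\<And>i xs. i \<in> I \<Longrightarrow> xs \<in> tuples X (ar i) \<Longrightarrow> xs \<in> \<rho> i \<longleftrightarrow> map f xs \<in> \<sigma> i"
    and "range s \<subseteq> X"
  shows "sat X \<rho> \<phi> s \<longleftrightarrow> sat X \<sigma> \<phi> (f \<circ> s)"
  using assms(1,4)
proof (induction arbitrary: s rule: formulas.induct)
  case (1 a b)
  then show ?case
    using inj_on_eq_iff[OF bij_betw_imp_inj_on[OF bij]] by (simp add: range_subsetD)
next
  case (2 i vs)
  then show ?case
    using iso[of i "map s vs"] by (simp add: map_in_tuples comp_def)
next
  case (4 \<phi> a)
  have "sat X \<rho> \<phi> (s(a := x)) \<longleftrightarrow> sat X \<sigma> \<phi> ((f \<circ> s)(a := f x))" if "x \<in> X" for x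
    using 4(2)[OF range_fun_upd_subset[OF 4(3) that]] by (simp only: fun_upd_comp)
  then have "(\<forall>x\<in>X. sat X \<rho> \<phi> (s(a := x))) \<longleftrightarrow>
      (\<forall>y\<in>f ` X. sat X \<sigma> \<phi> ((f \<circ> s)(a := y)))"
    by blast
  then show ?case
    unfolding bij_betw_imp_surj_on[OF bij] sat.simps .
next
  case (5 \<phi> a)
  have "sat X \<rho> \<phi> (s(a := x)) \<longleftrightarrow> sat X \<sigma> \<phi> ((f \<circ> s)(a := f x))" if "x \<in> X" for x
    using 5(2)[OF range_fun_upd_subset[OF 5(3) that]] by (simp only: fun_upd_comp)
  then have "(\<exists>x\<in>X. sat X \<rho> \<phi> (s(a := x))) \<longleftrightarrow>
      (\<exists>y\<in>f ` X. sat X \<sigma> \<phi> ((f \<circ> s)(a := y)))"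
    by blast
  then show ?case
    unfolding bij_betw_imp_surj_on[OF bij] sat.simps .
qed simp_all

lemma models_isomorphism:
  fixes T :: "('i, 'v, 'k) fm set"
  assumes "T \<subseteq> formulas I ar" and bij: "bij_betw f X X"
    and iso: "\<And>i xs. i \<in> I \<Longrightarrow> xs \<in> tuples X (ar i) \<Longrightarrow> xs \<in> \<rho> i \<longleftrightarrow> map f xs \<in> \<sigma> i"
  shows "models X \<rho> T \<longleftrightarrow> models X \<sigma> T"
proof -
  have sat_iff: "sat X \<rho> \<phi> s \<longleftrightarrow> sat X \<sigma> \<phi> (f \<circ> s)" if "\<phi> \<in> T" and "range s \<subseteq> X" for \<phi> s
    using assms(1) that by (intro sat_isomorphism[OF _ bij iso]) auto
  have fX: "f ` X = X"
    using bij by (rule bij_betw_imp_surj_on)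
  show ?thesis
  proof
    assume \<sigma>: "models X \<sigma> T"
    show "models X \<rho> T"
      unfolding models_def
    proof (intro ballI allI impI)
      fix \<phi> and s :: "'v \<Rightarrow> _"
      assume \<phi>: "\<phi> \<in> T" and s: "range s \<subseteq> X"
      have "range (f \<circ> s) \<subseteq> X"
        using s fX by auto
      then have "sat X \<sigma> \<phi> (f \<circ> s)"
        using \<sigma> \<phi> unfolding models_def by blast
      then show "sat X \<rho> \<phi> s"
        using sat_iff[OF \<phi> s] by (rule iffD2[rotated])
    qed
  next
    assume \<rho>: "models X \<rho> T"
    show "models X \<sigma> T"
      unfolding models_def
    proof (intro ballI allI impI)
      fix \<phi> and s :: "'v \<Rightarrow> _"
      assume \<phi>: "\<phi> \<in> T" and s: "range s \<subseteq> X"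
      \<comment> \<open>Surjectivity of \<open>f\<close> makes every assignment into
        \<open>X\<close> of the form \<open>f \<circ> t\<close>.\<close>
      define t where "t = inv_into X f \<circ> s"
      have s_in: "s a \<in> f ` X" for a
        using s fX by auto
      have t: "range t \<subseteq> X"
        using inv_into_into[OF s_in] by (auto simp: t_def)
      have "f \<circ> t = s"
        using f_inv_into_f[OF s_in] by (simp add: t_def fun_eq_iff)
      moreover have "sat X \<rho> \<phi> t"
        using \<rho> \<phi> t unfolding models_def by blast
      ultimately show "sat X \<sigma> \<phi> s"
        using sat_iff[OF \<phi> t] by simp
    qed
  qed
qed

lemma bij_betw_map_tuples:
  "bij_betw f X X \<Longrightarrow> xs \<in> tuples X n \<Longrightarrow> map f xs \<in> tuples X n"
  by (auto simp: tuples_def bij_betw_def)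

lemma map_eq_tuples_iff:
  assumes "bij_betw f X X" and "xs \<in> tuples X n" and "ys \<in> tuples X n"
  shows "map f xs = map f ys \<longleftrightarrow> xs = ys"
  using assms by (intro inj_on_map_eq_map) (auto simp: bij_betw_def tuples_def intro: inj_on_subset)

lemma maximal_reversible:
  assumes T: "T \<subseteq> formulas I ar" and \<tau>: "\<tau> \<in> maximals (interps_of I ar T X)"
  shows "reversible I ar X \<tau>"
  unfolding reversible_def
proof (intro allI impI, elim conjE)
  fix f assume f: "endomorphism I X \<tau> f" and bij: "bij_betw f X X"
  \<comment> \<open>For the preimage, the isomorphism condition holds by definition, and the
    endomorphism condition gives \<open>\<tau> \<le> \<rho>\<close>.\<close>
  define \<rho> where "\<rho> = (\<lambda>i\<in>I. {xs \<in> tuples X (ar i). map f xs \<in> \<tau> i})"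
  have \<tau>': "\<tau> \<in> interps I ar X" "models X \<tau> T"
    using \<tau> by (auto simp: maximals_def interps_of_def)
  have "models X \<rho> T"
    using models_isomorphism[OF T bij, of \<rho> \<tau>] \<tau>'(2) by (simp add: \<rho>_def)
  then have "\<rho> \<in> interps_of I ar T X"
    by (auto simp: \<rho>_def interps_of_def interps_def)
  moreover have "\<tau> \<le> \<rho>"
  proof (rule le_funI)
    fix i show "\<tau> i \<le> \<rho> i"
      using \<tau>'(1) f by (cases "i \<in> I") (auto simp: \<rho>_def interps_def endomorphism_def)
  qed
  ultimately have "\<rho> = \<tau>"
    using \<tau> by (simp add: maximals_def)
  \<comment> \<open>Once \<open>\<rho> = \<tau>\<close>, this equivalence is the automorphism
    condition.\<close>
  moreover have "xs \<in> \<rho> i \<longleftrightarrow> map f xs \<in> \<tau> i" if "i \<in> I" "xs \<in> tuples X (ar i)" for i xs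
    using that by (simp add: \<rho>_def)
  ultimately show "automorphism I ar X \<tau> f"
    using bij by (simp add: automorphism_def)
qed

lemma minimal_reversible:
  assumes T: "T \<subseteq> formulas I ar" and \<tau>: "\<tau> \<in> minimals (interps_of I ar T X)"
  shows "reversible I ar X \<tau>"
  unfolding reversible_def
proof (intro allI impI, elim conjE)
  fix f assume f: "endomorphism I X \<tau> f" and bij: "bij_betw f X X"
  define \<rho> where "\<rho> = (\<lambda>i\<in>I. map f ` \<tau> i)"
  have \<tau>': "\<tau> \<in> interps I ar X" "models X \<tau> T"
    using \<tau> by (auto simp: minimals_def interps_of_def)
  have sub: "\<tau> i \<subseteq> tuples X (ar i)" if "i \<in> I" for i
    using \<tau>'(1) that by (auto simp: interps_def)
  \<comment> \<open>Injectivity of \<open>map f\<close> on tuples keeps a tuple outside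
    \<open>\<tau> i\<close> from being mapped into the image.\<close>
  have iso: "xs \<in> \<tau> i \<longleftrightarrow> map f xs \<in> \<rho> i" if "i \<in> I" "xs \<in> tuples X (ar i)" for i xs
    using that sub[OF that(1)] map_eq_tuples_iff[OF bij] by (auto simp: \<rho>_def)
  have "models X \<rho> T"
    using models_isomorphism[OF T bij, of \<tau> \<rho>] iso \<tau>'(2) by simp
  moreover have "\<rho> \<in> interps I ar X"
    using sub bij_betw_map_tuples[OF bij] by (fastforce simp: \<rho>_def interps_def)
  moreover have "\<rho> \<le> \<tau>"
  proof (rule le_funI)
    fix i show "\<rho> i \<le> \<tau> i"
      using \<tau>'(1) f by (cases "i \<in> I") (auto simp: \<rho>_def interps_def endomorphism_def)
  qed
  ultimately have "\<rho> = \<tau>"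
    using \<tau> by (simp add: minimals_def interps_of_def)
  with bij iso show "automorphism I ar X \<tau> f"
    by (simp add: automorphism_def)
qed

section \<open>Complementation\<close>

lemma compl_interp_in_interps: "compl_interp I ar X \<rho> \<in> interps I ar X"
  by (auto simp: compl_interp_def interps_def)

lemma compl_interp_involution:
  assumes "\<rho> \<in> interps I ar X"
  shows "compl_interp I ar X (compl_interp I ar X \<rho>) = \<rho>"
proof
  fix i show "compl_interp I ar X (compl_interp I ar X \<rho>) i = \<rho> i"
    using assms by (cases "i \<in> I") (auto simp: compl_interp_def interps_def)
qed

lemma compl_interp_antimono:
  "\<rho> \<le> \<sigma> \<Longrightarrow> compl_interp I ar X \<sigma> \<le> compl_interp I ar X \<rho>"
  by (auto simp: compl_interp_def le_fun_def)

text \<open>Negating each relational atom cancels complementing its relation. The complement is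
  relative to \<open>tuples X (ar i)\<close>, so the evaluated tuple must lie there: hence the
  conditions on arities and on the range of \<open>s\<close>.\<close>

lemma sat_compl_fm:
  assumes "\<phi> \<in> formulas I ar" and "range s \<subseteq> X"
  shows "sat X (compl_interp I ar X \<rho>) (compl_fm \<phi>) s \<longleftrightarrow> sat X \<rho> \<phi> s"
  using assms
proof (induction arbitrary: s rule: formulas.induct)
  case (2 i vs)
  then show ?case
    by (simp add: compl_interp_def map_in_tuples)
next
  case (4 \<phi> a)
  have "sat X (compl_interp I ar X \<rho>) (compl_fm \<phi>) (s(a := x)) \<longleftrightarrow> sat X \<rho> \<phi> (s(a := x))"
    if "x \<in> X" for x
    by (rule 4(2)[OF range_fun_upd_subset[OF 4(3) that]])
  then show ?case
    by simp
next
  case (5 \<phi> a)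
  have "sat X (compl_interp I ar X \<rho>) (compl_fm \<phi>) (s(a := x)) \<longleftrightarrow> sat X \<rho> \<phi> (s(a := x))"
    if "x \<in> X" for x
    by (rule 5(2)[OF range_fun_upd_subset[OF 5(3) that]])
  then show ?case
    by simp
qed simp_all

text \<open>Reduces the comparison of two sentences \<open>eta\<close> to their quantifier-free
  matrices.\<close>

lemma sat_foldr_All_cong:
  assumes "\<And>s. range s \<subseteq> X \<Longrightarrow> sat X \<rho> \<phi> s \<longleftrightarrow> sat X \<sigma> \<psi> s" and "range s \<subseteq> X"
  shows "sat X \<rho> (foldr (\<lambda>n. All (v n)) ns \<phi>) s \<longleftrightarrow> sat X \<sigma> (foldr (\<lambda>n. All (v n)) ns \<psi>) s"
  using assms(2)
proof (induction ns arbitrary: s)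
  case (Cons n ns)
  have "sat X \<rho> (foldr (\<lambda>n. All (v n)) ns \<phi>) (s(v n := x)) \<longleftrightarrow>
      sat X \<sigma> (foldr (\<lambda>n. All (v n)) ns \<psi>) (s(v n := x))" if "x \<in> X" for x
    by (rule Cons.IH[OF range_fun_upd_subset[OF Cons.prems that]])
  then show ?case
    by simp
qed (simp add: assms(1))

text \<open>Applying \<open>compl_fm\<close> to \<open>eta\<close> would turn
  \<open>Neg (Rel i vs)\<close> into a double negation, so the two sentences are compared
  semantically. On tuples over \<open>{..<m}\<close> complementing \<open>F\<close> flips each
  literal, which cancels the complement of \<open>\<rho>\<close>.\<close>

lemma sat_eta_compl:
  assumes "finite I" and "range s \<subseteq> X"
  shows "sat X (compl_interp I ar X \<rho>) (eta I ar v m (compl_interp I ar {..<m} F)) s \<longleftrightarrow>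
    sat X \<rho> (eta I ar v m F) s"
  unfolding eta_def
proof (rule sat_foldr_All_cong[OF _ assms(2)])
  fix s :: "'c \<Rightarrow> 'b" assume s: "range s \<subseteq> X"
  have "map s (map v x) \<in> tuples X (ar i)" if "x \<in> tuples {..<m} (ar i)" for x i
    using s that by (intro map_in_tuples) (auto simp: tuples_def)
  then show "sat X (compl_interp I ar X \<rho>)
      (disj2 (disj_over {(j, k). j < k \<and> k < m} (\<lambda>(j, k). Eq (v j) (v k)))
        (disj_over I (\<lambda>i. disj_over (tuples {..<m} (ar i))
          (\<lambda>x. if x \<in> compl_interp I ar {..<m} F i then Neg (Rel i (map v x))
            else Rel i (map v x))))) s \<longleftrightarrow>
    sat X \<rho>
      (disj2 (disj_over {(j, k). j < k \<and> k < m} (\<lambda>(j, k). Eq (v j) (v k)))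
        (disj_over I (\<lambda>i. disj_over (tuples {..<m} (ar i))
          (\<lambda>x. if x \<in> F i then Neg (Rel i (map v x)) else Rel i (map v x))))) s"
    by (auto simp: sat_disj2 sat_disj_over finite_increasing_pairs finite_tuples assms(1)
        compl_interp_def)
qed

lemma maximals_iff_minimals_antitone:
  assumes "A \<subseteq> S" and "B \<subseteq> S"
    and in_S: "\<And>x. x \<in> S \<Longrightarrow> c x \<in> S" and inv: "\<And>x. x \<in> S \<Longrightarrow> c (c x) = x"
    and anti: "\<And>x y. x \<le> y \<Longrightarrow> c y \<le> c x"
    and AB: "\<And>x. x \<in> S \<Longrightarrow> c x \<in> B \<longleftrightarrow> x \<in> A" and x: "x \<in> S"
  shows "x \<in> maximals A \<longleftrightarrow> c x \<in> minimals B"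
proof
  assume m: "x \<in> maximals A"
  have "y = c x" if y: "y \<in> B" "y \<le> c x" for y
  proof -
    \<comment> \<open>Since \<open>c (c y) = y\<close> is in \<open>B\<close>, \<open>AB\<close>
      puts \<open>c y\<close> into \<open>A\<close>; applying \<open>c\<close> to
      \<open>y \<le> c x\<close> gives \<open>x \<le> c y\<close>.\<close>
    have "y \<in> S" "c y \<in> A" "x \<le> c y"
      using y assms(2) AB[of "c y"] in_S inv anti[OF y(2)] x by auto
    then have "c y = x"
      using m by (auto simp: maximals_def)
    then show ?thesis
      using inv[OF \<open>y \<in> S\<close>] by simp
  qed
  then show "c x \<in> minimals B"
    using m x AB by (auto simp: maximals_def minimals_def)
next
  assume m: "c x \<in> minimals B"
  have "y = x" if y: "y \<in> A" "x \<le> y" for y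
  proof -
    have "y \<in> S" "c y \<in> B" "c y \<le> c x"
      using y assms(1) AB[of y] anti[OF y(2)] by auto
    then have "c y = c x"
      using m by (auto simp: minimals_def)
    then show ?thesis
      using inv[OF \<open>y \<in> S\<close>] inv[OF x] by metis
  qed
  then show "x \<in> maximals A"
    using m x AB by (auto simp: maximals_def minimals_def)
qed

theorem theorem5p2:
  fixes I :: "'i set" and ar :: "'i \<Rightarrow> nat" and X :: "'a set"
    and v :: "nat \<Rightarrow> 'v"
    and T :: "('i, 'v, 'k::infinite) fm set"
    and J :: "'j set" and m :: "'j \<Rightarrow> nat" and F :: "'j \<Rightarrow> 'i \<Rightarrow> nat list set"
    and P :: "('i \<Rightarrow> 'a list set) set"
  assumes "finite I" and "X \<noteq> {}" and "inj v"
    and "T \<subseteq> sentences I ar"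
    and "\<forall>j\<in>J. F j \<in> interps I ar {..<m j}"
  defines "P \<equiv> interps_of I ar (T \<union> (\<lambda>j. eta I ar v (m j) (F j)) ` J) X"
  assumes "P \<noteq> {}"
  shows "(T \<subseteq> class_F I ar \<longrightarrow>
            union_complete P \<and> codense_in (maximals P) P \<and>
            (\<forall>\<tau>\<in>maximals P. reversible I ar X \<tau>))
       \<and> (T \<subseteq> class_G I ar \<longrightarrow>
            intersection_complete P \<and> dense_in (minimals P) P \<and>
            (\<forall>\<tau>\<in>minimals P. reversible I ar X \<tau>))
       \<and> (\<forall>\<tau>\<in>interps I ar X.
            \<tau> \<in> maximals P \<longleftrightarrow>
            compl_interp I ar X \<tau> \<in> minimals (interps_of I ar
              (compl_fm ` T \<union>
                (\<lambda>j. eta I ar v (m j) (compl_interp I ar {..<m j} (F j))) ` J) X))"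
proof -
  let ?E = "(\<lambda>j. eta I ar v (m j) (F j)) ` J :: ('i, 'v, 'k) fm set"
  let ?c = "compl_interp I ar X"
  let ?Q = "interps_of I ar (compl_fm ` T \<union>
    (\<lambda>j. eta I ar v (m j) (compl_interp I ar {..<m j} (F j))) ` J) X"
  have EF: "?E \<subseteq> class_F I ar" and EG: "?E \<subseteq> class_G I ar"
    using eta_in_class_F[OF \<open>finite I\<close>] eta_in_class_G[OF \<open>finite I\<close>] by blast+
  have T: "T \<subseteq> formulas I ar"
    using \<open>T \<subseteq> sentences I ar\<close> by (auto simp: sentences_def)
  \<comment> \<open>Isomorphism invariance requires well-formed formulas; for \<open>eta\<close>
    this follows from membership in \<open>class_F\<close>.\<close>
  have fm: "T \<union> ?E \<subseteq> formulas I ar"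
    using T EF class_F_formulas by blast
  have a: "union_complete P" if "T \<subseteq> class_F I ar"
    unfolding P_def using that EF by (intro union_complete_interps_of) simp
  have b: "intersection_complete P" if "T \<subseteq> class_G I ar"
    unfolding P_def using that EG by (intro intersection_complete_interps_of) simp
  \<comment> \<open>The two parts of the theory are treated separately: \<open>T\<close> is
    complemented syntactically, the sentences \<open>eta\<close> through their finite
    structures.\<close>
  have "models X (?c \<rho>) (compl_fm ` T) \<longleftrightarrow> models X \<rho> T" for \<rho>
    using T sat_compl_fm[of _ I ar _ X \<rho>] unfolding models_def by blast
  moreover have "models X (?c \<rho>)
      ((\<lambda>j. eta I ar v (m j) (compl_interp I ar {..<m j} (F j)) :: ('i, 'v, 'k) fm) ` J) \<longleftrightarrow>
    models X \<rho> ?E" for \<rho>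
    unfolding models_def ball_simps
    by (intro ball_cong refl all_cong sat_eta_compl \<open>finite I\<close>)
  ultimately have "?c \<rho> \<in> ?Q \<longleftrightarrow> \<rho> \<in> P" if "\<rho> \<in> interps I ar X" for \<rho>
    using that by (simp add: P_def interps_of_def compl_interp_in_interps models_Un)
  then have c: "\<tau> \<in> maximals P \<longleftrightarrow> ?c \<tau> \<in> minimals ?Q" if "\<tau> \<in> interps I ar X" for \<tau>
    using that compl_interp_in_interps compl_interp_involution compl_interp_antimono
    by (intro maximals_iff_minimals_antitone[where S = "interps I ar X"])
      (auto simp: P_def interps_of_def)
  show ?thesis
    using a b c union_complete_codense_maximals[of P] intersection_complete_dense_minimals[of P]
      maximal_reversible[OF fm, of _ X] minimal_reversible[OF fm, of _ X]
    by (simp add: P_def)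
qed

end
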